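(* Let $m\ge 1$ and $n\ge 2$, let $H\in\mathcal{BH}(m,n)$ be a normalized Butson matrix with core $C$, and denote by $\mathbf{c}_i$ the $i$-th row of $C$ ($1\le i\le n-1$). Let $\mathbb{X}=\{\mathcal{X}^{(1)},\dots,\mathcal{X}^{(n-2)}\}$ be a complete tensor set of LSESC of order $n-1$, and let $\mathbf{X}^{(s)}_k$ denote the $k$-th frontal slice of $\mathcal{X}^{(s)}$. Let $H'$ be the $(n-1)\times n$ matrix obtained from $H$ by deleting its first row, let $B_0=H'\otimes\mathbf{J}_{n-1}$, and let $$B=\left[\begin{array}{c|cccc} \mathbf{J}_{n-1}^{\top}\otimes\mathbf{c}_1&C&C&\cdots&C\\ \mathbf{J}_{n-1}^{\top}\otimes\mathbf{c}_2&\mathbf{X}^{(1)}_{1}C&\mathbf{X}^{(1)}_{2}C&\cdots&\mathbf{X}^{(1)}_{n-1}C\\ \mathbf{J}_{n-1}^{\top}\otimes\mathbf{c}_3&\mathbf{X}^{(2)}_{1}C&\mathbf{X}^{(2)}_{2}C&\cdots&\mathbf{X}^{(2)}_{n-1}C\\ \vdots&\vdots&\vdots&&\vdots\\ \mathbf{J}_{n-1}^{\top}\otimes\mathbf{c}_{n-1}&\mathbf{X}^{(n-2)}_{1}C&\mathbf{X}^{(n-2)}_{2}C&\cdots&\mathbf{X}^{(n-2)}_{n-1}C \end{array}\right].$$ Then the matrix $$\Phi_{\mathbb{X}}(H)=\left[\begin{array}{c}B_0\\ B\end{array}\right]$$ is a Butson matrix of order $n(n-1)$ whose entries are complex $m$-th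 roots of unity, i.e. a $BH(m,n(n-1))$.
   Context: A Butson matrix $BH(m,n)$ is an $n\times n$ matrix $M$ whose entries are complex $m$-th roots of unity (complex numbers $z$ with $z^m=1$) and which satisfies $MM^*=nI_n$, where $M^*$ is the conjugate transpose. It is normalized if its first row and first column consist entirely of ones. $\mathcal{BH}(m,n)$ is the set of all normalized $BH(m,n)$ matrices. The core of a normalized Butson matrix of order $n$ is the $(n-1)\times(n-1)$ matrix obtained by deleting its first row and first column. $\mathbf{J}_k$ is the $1\times k$ row vector of all ones. The Kronecker product of $X=(x_{ij})$ and $Y$ is the block matrix $X\otimes Y=(x_{ij}Y)$. A Latin square of order $k$ is a $k\times k$ matrix with entries in $\{1,\dots,k\}$ in which each symbol appears exactly once in each row and in each column. Two Latin squares $L=(l_{ij})$ and $L'=(l'_{ij})$ of order $k$ are said to be LSESC (Latin squares eligible for Scarpis construction) if for all $i,i'\in\{1,\dots,k\}$ there is a unique $j\in\{1,\dots,k\}$ with $l_{ij}=l'_{i'j}$. A complete set of LSESC of order $k$ is a set $\{L^{(1)},\dots,L^{(k-1)}\}$ of $k-1$ Latin squares of order $k$ such that any two distinct members are LSESC. To a Latin square $L$ of order $k$ associate the cubic tensor $F(L)$ of dimensions $k\times k\times k$ whose frontal slices are the $k\times k$ permutation matrices $\mathbf{X}_1,\dots,\mathbf{X}_k$, where the $(i,j)$ entry of $\mathbf{X}_t$ is $1$ if $l_{it}=j$ and $0$ otherwise. A complete tensor set of LSESC of order $k$ is $\{F(L^{(1)}),\dots,F(L^{(k-1)})\}$ for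 a complete set of LSESC $\{L^{(1)},\dots,L^{(k-1)}\}$ of order $k$. *)

theory Defs
  imports
    Complex_Main
    "Jordan_Normal_Form.Matrix"
    "Jordan_Normal_Form.Determinant"
    "Jordan_Normal_Form.Schur_Decomposition"
begin

text \<open>Rows and columns of matrices, block positions, frontal slices and lists are indexed from 0;
  the symbols of a Latin square of order \<open>k\<close> are \<open>1, \<dots>, k\<close>.\<close>

definition butson :: "nat \<Rightarrow> nat \<Rightarrow> complex mat \<Rightarrow> bool" where
  "butson m n M \<longleftrightarrow>
     M \<in> carrier_mat n n \<and>
     (\<forall>i<n. \<forall>j<n. (M $$ (i, j)) ^ m = 1) \<and>
     M * mat_adjoint M = of_nat n \<cdot>\<^sub>m 1\<^sub>m n"

definition normalized_butson :: "nat \<Rightarrow> nat \<Rightarrow> complex mat set" where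
  "normalized_butson m n =
     {M. butson m n M \<and> (\<forall>j<n. M $$ (0, j) = 1) \<and> (\<forall>i<n. M $$ (i, 0) = 1)}"

definition core :: "'a mat \<Rightarrow> 'a mat" where
  "core H = mat_delete H 0 0"

definition delete_first_row :: "'a mat \<Rightarrow> 'a mat" where
  "delete_first_row H = mat (dim_row H - 1) (dim_col H) (\<lambda>(i, j). H $$ (Suc i, j))"

definition ones_row :: "nat \<Rightarrow> 'a :: one mat" where
  "ones_row k = mat 1 k (\<lambda>_. 1)"

text \<open>The \<open>p \<times> q\<close> grid of blocks \<open>f a b\<close>, each of dimensions \<open>r \<times> c\<close>.\<close>

definition block_matrix ::
  "nat \<Rightarrow> nat \<Rightarrow> nat \<Rightarrow> nat \<Rightarrow> (nat \<Rightarrow> nat \<Rightarrow> 'a mat) \<Rightarrow> 'a mat" where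
  "block_matrix p q r c f =
     mat (p * r) (q * c) (\<lambda>(i, j). f (i div r) (j div c) $$ (i mod r, j mod c))"

definition kronecker :: "'a :: semiring_0 mat \<Rightarrow> 'a mat \<Rightarrow> 'a mat" where
  "kronecker X Y =
     block_matrix (dim_row X) (dim_col X) (dim_row Y) (dim_col Y) (\<lambda>a b. X $$ (a, b) \<cdot>\<^sub>m Y)"

definition latin_square :: "nat \<Rightarrow> nat mat \<Rightarrow> bool" where
  "latin_square k L \<longleftrightarrow>
     L \<in> carrier_mat k k \<and>
     (\<forall>i<k. \<forall>j<k. L $$ (i, j) \<in> {1..k}) \<and>
     (\<forall>i<k. \<forall>x\<in>{1..k}. \<exists>!j. j < k \<and> L $$ (i, j) = x) \<and>
     (\<forall>j<k. \<forall>x\<in>{1..k}. \<exists>!i. i < k \<and> L $$ (i, j) = x)"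

definition lsesc :: "nat \<Rightarrow> nat mat \<Rightarrow> nat mat \<Rightarrow> bool" where
  "lsesc k L L' \<longleftrightarrow>
     latin_square k L \<and> latin_square k L' \<and>
     (\<forall>i<k. \<forall>i'<k. \<exists>!j. j < k \<and> L $$ (i, j) = L' $$ (i', j))"

definition complete_lsesc :: "nat \<Rightarrow> nat mat set \<Rightarrow> bool" where
  "complete_lsesc k S \<longleftrightarrow>
     finite S \<and> card S = k - 1 \<and> (\<forall>L\<in>S. latin_square k L) \<and> pairwise (lsesc k) S"

text \<open>A cubic tensor is represented by the list of its frontal slices.\<close>

type_synonym 'a tensor3 = "'a mat list"

definition frontal_slice :: "'a tensor3 \<Rightarrow> nat \<Rightarrow> 'a mat" where
  "frontal_slice X t = X ! t"

text \<open>The symbol \<open>Suc j\<close> marks column \<open>j\<close>, since symbols start at 1 and columns at 0.\<close>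

definition latin_tensor :: "nat mat \<Rightarrow> complex tensor3" where
  "latin_tensor L =
     (let k = dim_row L in
      map (\<lambda>t. mat k k (\<lambda>(i, j). if L $$ (i, t) = Suc j then 1 else 0)) [0..<k])"

definition complete_lsesc_tensors :: "nat \<Rightarrow> complex tensor3 set \<Rightarrow> bool" where
  "complete_lsesc_tensors k T \<longleftrightarrow> (\<exists>S. complete_lsesc k S \<and> T = latin_tensor ` S)"

definition scarpis_top :: "complex mat \<Rightarrow> complex mat" where
  "scarpis_top H = kronecker (delete_first_row H) (ones_row (dim_row H - 1))"

definition scarpis_bottom :: "complex tensor3 list \<Rightarrow> complex mat \<Rightarrow> complex mat" where
  "scarpis_bottom Xs H =
     (let n = dim_row H; C = core H in
      block_matrix (n - 1) n (n - 1) (n - 1)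
        (\<lambda>a b. if b = 0 then kronecker (transpose_mat (ones_row (n - 1))) (mat_of_row (row C a))
               else if a = 0 then C
               else frontal_slice (Xs ! (a - 1)) (b - 1) * C))"

definition scarpis :: "complex tensor3 list \<Rightarrow> complex mat \<Rightarrow> complex mat" where
  "scarpis Xs H = scarpis_top H @\<^sub>r scarpis_bottom Xs H"

end

theory Submission
  imports Defs
begin

text \<open>Write \<open>k = n - 1\<close>. Each of the \<open>n\<close> blocks of a bottom row is a row of the core, so the row is
  a word of length \<open>n\<close> over \<open>k\<close> symbols. Rows of the core have inner product \<open>n \<delta> - 1\<close>, hence
  two bottom rows whose words agree in \<open>e\<close> positions have inner product \<open>n e - n\<close>, and distinct
  words of the construction agree exactly once: in the leading block if they come from the same
  block row, and otherwise in one later block, by the LSESC property or, against the constant words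
  of the first block row, by the Latin property. A row of the core sums
  to \<open>-1\<close>, so top and bottom rows are orthogonal because rows of \<open>H\<close> other than the first sum to
  \<open>0\<close>.\<close>

section \<open>Block sums and the Butson condition in coordinates\<close>

text \<open>The indices below \<open>p * k\<close> fall into \<open>p\<close> consecutive intervals
  of length \<open>k\<close>; each is shifted to start at 0.\<close>

lemma sum_div_mod:
  fixes f :: "nat \<Rightarrow> nat \<Rightarrow> 'a::comm_monoid_add"
  shows "(\<Sum>l<p * k. f (l div k) (l mod k)) = (\<Sum>b<p. \<Sum>c<k. f b c)"
proof -
  have "(\<Sum>l<p * k. f (l div k) (l mod k)) =
      (\<Sum>b<p. \<Sum>l\<in>{b * k..<b * k + k}. f (l div k) (l mod k))"
    by (rule sum.nat_group[symmetric])
  also have "\<dots> = (\<Sum>b<p. \<Sum>c<k. f b c)"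
  proof (rule sum.cong[OF refl])
    fix b
    show "(\<Sum>l\<in>{b * k..<b * k + k}. f (l div k) (l mod k)) = (\<Sum>c<k. f b c)"
      using sum.shift_bounds_nat_ivl[of "\<lambda>l. f (l div k) (l mod k)" 0 "b * k" k]
      by (simp add: add.commute atLeast0LessThan)
  qed
  finally show ?thesis .
qed

lemma mat_mult_adjoint_index:
  assumes "M \<in> carrier_mat n q" "i < n" "j < n"
  shows "(M * mat_adjoint M) $$ (i, j) = (\<Sum>l<q. M $$ (i, l) * cnj (M $$ (j, l)))"
  using assms by (auto simp: mat_adjoint_def scalar_prod_def mat_of_rows_index
      conjugate_complex_def atLeast0LessThan intro!: sum.cong)

text \<open>Off the diagonal and on it, the matrix equation is a statement about inner products of
  rows, the form in which the construction is checked.\<close>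

lemma butson_iff:
  "butson m n M \<longleftrightarrow> M \<in> carrier_mat n n \<and> (\<forall>i<n. \<forall>j<n. (M $$ (i, j)) ^ m = 1) \<and>
     (\<forall>i<n. \<forall>j<n. (\<Sum>l<n. M $$ (i, l) * cnj (M $$ (j, l))) = (if i = j then of_nat n else 0))"
proof -
  have "M * mat_adjoint M = of_nat n \<cdot>\<^sub>m 1\<^sub>m n \<longleftrightarrow>
     (\<forall>i<n. \<forall>j<n. (\<Sum>l<n. M $$ (i, l) * cnj (M $$ (j, l))) = (if i = j then of_nat n else 0))"
    if "M \<in> carrier_mat n n"
  proof -
    have dims: "dim_row (M * mat_adjoint M) = n" "dim_col (M * mat_adjoint M) = n"
      using that by (auto simp: mat_adjoint_def)
    show ?thesis
      unfolding mat_eq_iff dims by (auto simp: mat_mult_adjoint_index[OF that])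
  qed
  then show ?thesis
    by (auto simp: butson_def)
qed

section \<open>Normalized Butson matrices and their cores\<close>

locale normalized_butson_matrix =
  fixes m n k :: nat and H :: "complex mat"
  assumes n: "n = Suc k" and k: "0 < k" and H: "H \<in> normalized_butson m n"
begin

lemma Suc_less_n [simp]: "Suc x < n \<longleftrightarrow> x < k"
  using n by simp

lemma n_minus_1 [simp]: "n - Suc 0 = k"
  using n by simp

lemma H_butson: "butson m n H"
  using H by (simp add: normalized_butson_def)

lemma H_carrier: "H \<in> carrier_mat n n"
  using H_butson by (simp add: butson_iff)

lemma H_dims [simp]: "dim_row H = n" "dim_col H = n"
  using H_carrier by auto

lemma H_root: "i < n \<Longrightarrow> j < n \<Longrightarrow> H $$ (i, j) ^ m = 1"
  using H_butson by (simp add: butson_iff)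

lemma H_orthogonal:
  "i < n \<Longrightarrow> j < n \<Longrightarrow>
     (\<Sum>l<n. H $$ (i, l) * cnj (H $$ (j, l))) = (if i = j then of_nat n else 0)"
  using H_butson by (simp add: butson_iff)

lemma H_first: "j < n \<Longrightarrow> H $$ (0, j) = 1" "i < n \<Longrightarrow> H $$ (i, 0) = 1"
  using H by (auto simp: normalized_butson_def)

text \<open>The first row is all ones, so the row sum is an inner product with it.\<close>

lemma sum_H_row:
  assumes "0 < i" "i < n"
  shows "(\<Sum>l<n. H $$ (i, l)) = 0"
proof -
  have "(\<Sum>l<n. H $$ (i, l)) = (\<Sum>l<n. H $$ (i, l) * cnj (H $$ (0, l)))"
    by (simp add: H_first)
  also have "\<dots> = 0"
    using assms by (subst H_orthogonal) auto
  finally show ?thesis .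
qed

lemma core_carrier: "core H \<in> carrier_mat k k"
  using n by (simp add: core_def mat_delete_def)

lemma core_dims [simp]: "dim_row (core H) = k" "dim_col (core H) = k"
  using core_carrier by auto

lemma core_index: "x < k \<Longrightarrow> y < k \<Longrightarrow> core H $$ (x, y) = H $$ (Suc x, Suc y)"
  using n by (simp add: core_def mat_delete_def)

lemma sum_split_first: "(\<Sum>l<n. f l) = f 0 + (\<Sum>c<k. f (Suc c))" for f :: "nat \<Rightarrow> complex"
  unfolding n by (rule sum.lessThan_Suc_shift)

text \<open>The full row of \<open>H\<close> sums to 0, and its deleted leading entry is 1.\<close>

lemma core_row_sum:
  assumes "x < k"
  shows "(\<Sum>c<k. core H $$ (x, c)) = -1"
proof -
  have "0 = 1 + (\<Sum>c<k. core H $$ (x, c))"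
    using sum_H_row[of "Suc x"] assms by (simp add: sum_split_first H_first core_index)
  then show ?thesis
    by (simp add: eq_neg_iff_add_eq_0 add.commute)
qed

text \<open>The deleted column of ones contributes exactly 1 to the inner product of the full rows
  of \<open>H\<close>.\<close>

lemma core_inner:
  assumes "x < k" "y < k"
  shows "(\<Sum>c<k. core H $$ (x, c) * cnj (core H $$ (y, c))) =
      (if x = y then of_nat n else 0) - 1"
proof -
  have "(if x = y then of_nat n else 0) =
      1 + (\<Sum>c<k. core H $$ (x, c) * cnj (core H $$ (y, c)))"
    using H_orthogonal[of "Suc x" "Suc y"] assms
    by (simp add: sum_split_first H_first core_index)
  then show ?thesis
    by simp
qed

end

section \<open>Latin squares and their tensors\<close>

lemma latin_square_entry:
  assumes "latin_square k L" "i < k" "j < k"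
  shows "1 \<le> L $$ (i, j)" "L $$ (i, j) \<le> k"
  using assms by (auto simp: latin_square_def)

lemma latin_tensor_slice_index:
  assumes "L \<in> carrier_mat k k" "t < k" "i < k" "j < k"
  shows "frontal_slice (latin_tensor L) t $$ (i, j) = (if L $$ (i, t) = Suc j then 1 else 0)"
  using assms by (auto simp: frontal_slice_def latin_tensor_def Let_def)

lemma latin_tensor_slice_carrier:
  assumes "L \<in> carrier_mat k k" "t < k"
  shows "frontal_slice (latin_tensor L) t \<in> carrier_mat k k"
  using assms by (auto simp: frontal_slice_def latin_tensor_def Let_def)

text \<open>The entry at \<open>(i, t)\<close> can be read off from the position of the 1 in row
  \<open>i\<close> of slice \<open>t\<close>.\<close>

lemma latin_tensor_inject:
  assumes "latin_square k L" "latin_square k L'" "latin_tensor L = latin_tensor L'"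
  shows "L = L'"
proof (rule eq_matI)
  have carrier: "L \<in> carrier_mat k k" "L' \<in> carrier_mat k k"
    using assms by (auto simp: latin_square_def)
  then show "dim_row L = dim_row L'" "dim_col L = dim_col L'"
    by auto
  fix i t
  assume "i < dim_row L'" "t < dim_col L'"
  then have it: "i < k" "t < k"
    using carrier by auto
  define j where "j = L $$ (i, t) - 1"
  have j: "j < k" "L $$ (i, t) = Suc j"
    using latin_square_entry[OF assms(1) it] by (auto simp: j_def)
  have "frontal_slice (latin_tensor L') t $$ (i, j) = 1"
    using latin_tensor_slice_index[OF carrier(1) it(2,1) j(1)] j(2) assms(3) by simp
  then show "L $$ (i, t) = L' $$ (i, t)"
    using latin_tensor_slice_index[OF carrier(2) it(2,1) j(1)] j(2)
    by (simp split: if_splits)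
qed

text \<open>A list enumerating the tensors enumerates them without repetition: the tensor
  determines its Latin square, so there are \<open>k - 1\<close> tensors.\<close>

lemma complete_lsesc_tensors_listE:
  assumes "complete_lsesc_tensors k (set Xs)" "length Xs = k - 1"
  obtains Ls where "Xs = map latin_tensor Ls" "distinct Ls" "\<forall>L\<in>set Ls. latin_square k L"
    "pairwise (lsesc k) (set Ls)"
proof -
  obtain S where S: "complete_lsesc k S" "set Xs = latin_tensor ` S"
    using assms(1) by (auto simp: complete_lsesc_tensors_def)
  have inj: "inj_on latin_tensor S"
    using S(1) latin_tensor_inject by (auto simp: complete_lsesc_def inj_on_def)
  have "card (set Xs) = length Xs"
    using S assms(2) card_image[OF inj] by (simp add: complete_lsesc_def)
  then have "distinct Xs"
    by (rule card_distinct)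
  \<comment> \<open>Pulling the tensors back one by one along the list keeps the order of the block
    rows.\<close>
  define Ls where "Ls = map (inv_into S latin_tensor) Xs"
  have "Xs = map latin_tensor Ls"
    using S(2) by (auto simp: Ls_def f_inv_into_f intro!: map_idI[symmetric])
  moreover from this have "distinct Ls"
    using \<open>distinct Xs\<close> distinct_map by auto
  moreover have "set Ls \<subseteq> S"
    using S(2) by (auto simp: Ls_def inv_into_into)
  ultimately show ?thesis
    using that S(1) by (auto simp: complete_lsesc_def intro: pairwise_subset)
qed

section \<open>Words of the bottom rows and their agreements\<close>

text \<open>Block \<open>b\<close> of the bottom row with index \<open>r\<close> in block row \<open>a\<close> is the row
  \<open>scarpis_symbol Ls a r b\<close> of the core.\<close>

definition scarpis_symbol :: "nat mat list \<Rightarrow> nat \<Rightarrow> nat \<Rightarrow> nat \<Rightarrow> nat" where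
  "scarpis_symbol Ls a r b =
     (if b = 0 then a else if a = 0 then r else (Ls ! (a - 1)) $$ (r, b - 1) - 1)"

locale scarpis_construction = normalized_butson_matrix +
  fixes Ls :: "nat mat list"
  assumes length_Ls: "length Ls = k - 1"
    and distinct_Ls: "distinct Ls"
    and latin_Ls: "L \<in> set Ls \<Longrightarrow> latin_square k L"
    and lsesc_Ls: "pairwise (lsesc k) (set Ls)"
begin

lemma nth_Ls:
  assumes "0 < a" "a < k"
  shows "latin_square k (Ls ! (a - 1))"
  using assms length_Ls by (intro latin_Ls) auto

text \<open>Distinctness of the list turns different block rows into different squares, and only to
  those does \<open>pairwise\<close> apply.\<close>

lemma nth_Ls_lsesc:
  assumes "0 < a" "a < k" "0 < a'" "a' < k" "a \<noteq> a'"
  shows "lsesc k (Ls ! (a - 1)) (Ls ! (a' - 1))"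
proof -
  have "Ls ! (a - 1) \<noteq> Ls ! (a' - 1)"
    using assms length_Ls distinct_Ls by (simp add: nth_eq_iff_index_eq)
  then show ?thesis
    using assms length_Ls by (intro pairwiseD[OF lsesc_Ls]) auto
qed

lemma scarpis_symbol_less:
  assumes "a < k" "r < k" "b < n"
  shows "scarpis_symbol Ls a r b < k"
proof (cases "a = 0 \<or> b = 0")
  case True
  then show ?thesis
    using assms by (auto simp: scarpis_symbol_def)
next
  case False
  then have "b - 1 < k"
    using assms(3) n by linarith
  then show ?thesis
    using False assms latin_square_entry[OF nth_Ls, of a r "b - 1"]
    by (auto simp: scarpis_symbol_def)
qed

text \<open>The \<open>k * k\<close> words of length \<open>n = k + 1\<close> thus form an
  equidistant code with all distances equal to \<open>k\<close>.\<close>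

lemma card_agreements:
  assumes "a < k" "r < k" "a' < k" "r' < k" "(a, r) \<noteq> (a', r')"
  shows "card {b. b < n \<and> scarpis_symbol Ls a r b = scarpis_symbol Ls a' r' b} = 1"
proof -
  let ?agree = "\<lambda>b. scarpis_symbol Ls a r b = scarpis_symbol Ls a' r' b"
  \<comment> \<open>Words from different block rows differ in the leading position, so only the
    later positions, shifted by one, remain to be examined.\<close>
  have later: "\<exists>!b. b < n \<and> ?agree b"
    if "a \<noteq> a'" and "\<exists>!j. j < k \<and> ?agree (Suc j)"
  proof -
    from that(2) obtain j where j: "j < k" "?agree (Suc j)"
      and uniq: "\<And>j'. j' < k \<Longrightarrow> ?agree (Suc j') \<Longrightarrow> j' = j"
      by blast
    show ?thesis
    proof (intro ex1I[of _ "Suc j"])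
      show "Suc j < n \<and> ?agree (Suc j)"
        using j n by simp
      fix b assume b: "b < n \<and> ?agree b"
      then have "b \<noteq> 0"
        using \<open>a \<noteq> a'\<close> by (metis scarpis_symbol_def)
      then obtain j' where "b = Suc j'"
        using not0_implies_Suc by blast
      then show "b = Suc j"
        using b uniq n by simp
    qed
  qed
  \<comment> \<open>Truncated subtraction can be cancelled because symbols start at 1.\<close>
  have pred_eq: "x - 1 = y - 1 \<longleftrightarrow> x = y" if "1 \<le> x" "1 \<le> y" for x y :: nat
    using that by auto
  consider (same) "a = a'" "r \<noteq> r'" | (left) "a = 0" "a' \<noteq> 0" | (right) "a \<noteq> 0" "a' = 0"
    | (diff) "a \<noteq> 0" "a' \<noteq> 0" "a \<noteq> a'"
    using assms(5) by (cases "a = a'") auto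
  then have "\<exists>!b. b < n \<and> ?agree b"
  proof cases
    case same
    have "\<not> ?agree b" if "0 < b" "b < n" for b
    proof (cases "a = 0")
      case True
      then show ?thesis
        using same that by (simp add: scarpis_symbol_def)
    next
      case False
      let ?L = "Ls ! (a - 1)"
      have L: "latin_square k ?L"
        using False assms by (intro nth_Ls) auto
      have b: "b - 1 < k"
        using that n by simp
      \<comment> \<open>A symbol occurs only once in a column, so the distinct rows \<open>r\<close>
        and \<open>r'\<close> carry different symbols there.\<close>
      have "?L $$ (r, b - 1) \<noteq> ?L $$ (r', b - 1)"
        using L b assms(2,4) same(2) unfolding latin_square_def by metis
      then show ?thesis
        using False that same(1) latin_square_entry[OF L assms(2) b]
          latin_square_entry[OF L assms(4) b]
        by (simp add: scarpis_symbol_def pred_eq del: One_nat_def)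
    qed
    moreover have "0 < n" "?agree 0"
      using n same by (simp_all add: scarpis_symbol_def)
    ultimately show ?thesis
      by (intro ex1I[of _ 0]) auto
  next
    case left
    have L: "latin_square k (Ls ! (a' - 1))"
      using left assms by (intro nth_Ls) auto
    \<comment> \<open>The word of block row 0 is constantly \<open>r\<close> after its leading
      position, which corresponds to the symbol \<open>Suc r\<close>; row \<open>r'\<close> of the
      square contains it exactly once.\<close>
    have "\<exists>!j. j < k \<and> (Ls ! (a' - 1)) $$ (r', j) = Suc r"
      using L assms by (simp add: latin_square_def)
    moreover have "?agree (Suc j) \<longleftrightarrow> (Ls ! (a' - 1)) $$ (r', j) = Suc r" if "j < k" for j
      using left latin_square_entry[OF L assms(4) that] by (auto simp: scarpis_symbol_def)
    ultimately have "\<exists>!j. j < k \<and> ?agree (Suc j)"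
      by (simp cong: conj_cong)
    then show ?thesis
      using left by (intro later) auto
  next
    case right
    have L: "latin_square k (Ls ! (a - 1))"
      using right assms by (intro nth_Ls) auto
    have "\<exists>!j. j < k \<and> (Ls ! (a - 1)) $$ (r, j) = Suc r'"
      using L assms by (simp add: latin_square_def)
    moreover have "?agree (Suc j) \<longleftrightarrow> (Ls ! (a - 1)) $$ (r, j) = Suc r'" if "j < k" for j
      using right latin_square_entry[OF L assms(2) that] by (auto simp: scarpis_symbol_def)
    ultimately have "\<exists>!j. j < k \<and> ?agree (Suc j)"
      by (simp cong: conj_cong)
    then show ?thesis
      using right by (intro later) auto
  next
    case diff
    have E: "lsesc k (Ls ! (a - 1)) (Ls ! (a' - 1))"
      using diff assms by (intro nth_Ls_lsesc) auto
    then have L: "latin_square k (Ls ! (a - 1))" "latin_square k (Ls ! (a' - 1))"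
      by (auto simp: lsesc_def)
    have "\<exists>!j. j < k \<and> (Ls ! (a - 1)) $$ (r, j) = (Ls ! (a' - 1)) $$ (r', j)"
      using E assms by (simp add: lsesc_def)
    moreover have "?agree (Suc j) \<longleftrightarrow> (Ls ! (a - 1)) $$ (r, j) = (Ls ! (a' - 1)) $$ (r', j)"
      if "j < k" for j
    proof -
      have "?agree (Suc j) \<longleftrightarrow> (Ls ! (a - 1)) $$ (r, j) - 1 = (Ls ! (a' - 1)) $$ (r', j) - 1"
        using diff by (simp add: scarpis_symbol_def)
      also have "\<dots> \<longleftrightarrow> (Ls ! (a - 1)) $$ (r, j) = (Ls ! (a' - 1)) $$ (r', j)"
        using latin_square_entry[OF L(1) assms(2) that] latin_square_entry[OF L(2) assms(4) that]
        by (intro pred_eq)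
      finally show ?thesis .
    qed
    ultimately have "\<exists>!j. j < k \<and> ?agree (Suc j)"
      by (simp cong: conj_cong)
    then show ?thesis
      using diff by (intro later) auto
  qed
  then obtain b where "{b. b < n \<and> ?agree b} = {b}"
    by blast
  then show ?thesis
    by simp
qed

section \<open>Entries of the construction\<close>

text \<open>Row \<open>r\<close> of the slice has its single 1 in the column marked by the symbol at
  \<open>(r, t)\<close>, so the product selects that row of the core.\<close>

lemma slice_times_core_index:
  assumes "0 < a" "a < k" "t < k" "r < k" "c < k"
  shows "(frontal_slice (latin_tensor (Ls ! (a - 1))) t * core H) $$ (r, c) =
      core H $$ ((Ls ! (a - 1)) $$ (r, t) - 1, c)"
proof -
  let ?L = "Ls ! (a - 1)"
  have L: "latin_square k ?L"
    using assms by (intro nth_Ls)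
  then have LC: "?L \<in> carrier_mat k k"
    by (simp add: latin_square_def)
  have slice: "frontal_slice (latin_tensor ?L) t \<in> carrier_mat k k"
    using LC assms by (intro latin_tensor_slice_carrier)
  have "(frontal_slice (latin_tensor ?L) t * core H) $$ (r, c) =
      (\<Sum>j<k. frontal_slice (latin_tensor ?L) t $$ (r, j) * core H $$ (j, c))"
    using slice assms by (simp add: scalar_prod_def atLeast0LessThan)
  also have "\<dots> = (\<Sum>j<k. if j = ?L $$ (r, t) - 1 then core H $$ (j, c) else 0)"
  proof (rule sum.cong[OF refl])
    fix j assume "j \<in> {..<k}"
    then have "frontal_slice (latin_tensor ?L) t $$ (r, j) = (if ?L $$ (r, t) = Suc j then 1 else 0)"
      by (intro latin_tensor_slice_index[OF LC assms(3,4)]) simp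
    \<comment> \<open>The symbol is at least 1, which makes the predecessor faithful.\<close>
    moreover have "?L $$ (r, t) = Suc j \<longleftrightarrow> j = ?L $$ (r, t) - 1"
      using latin_square_entry[OF L assms(4,3)] by linarith
    ultimately show "frontal_slice (latin_tensor ?L) t $$ (r, j) * core H $$ (j, c) =
        (if j = ?L $$ (r, t) - 1 then core H $$ (j, c) else 0)"
      by simp
  qed
  also have "\<dots> = core H $$ (?L $$ (r, t) - 1, c)"
    using assms latin_square_entry[OF L assms(4,3)] by simp
  finally show ?thesis .
qed

lemma scarpis_top_carrier: "scarpis_top H \<in> carrier_mat k (n * k)"
  by (simp add: scarpis_top_def kronecker_def block_matrix_def delete_first_row_def ones_row_def)

lemma scarpis_bottom_carrier: "scarpis_bottom Xs H \<in> carrier_mat (k * k) (n * k)"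
  by (simp add: scarpis_bottom_def Let_def block_matrix_def)

lemma scarpis_carrier: "scarpis Xs H \<in> carrier_mat (n * k) (n * k)"
proof -
  have "k + k * k = n * k"
    using n by simp
  then show ?thesis
    using carrier_append_rows[OF scarpis_top_carrier scarpis_bottom_carrier[of Xs]]
    by (simp only: scarpis_def)
qed

text \<open>A column is addressed by its block \<open>b\<close> and its offset \<open>c\<close>, so
  that inner products become double sums. Top rows are constant in \<open>c\<close>, because the
  Kronecker factor repeats every entry of \<open>H\<close> \<open>k\<close> times.\<close>

definition scarpis_entry :: "nat \<Rightarrow> nat \<Rightarrow> nat \<Rightarrow> complex" where
  "scarpis_entry i b c =
     (if i < k then H $$ (Suc i, b)
      else core H $$ (scarpis_symbol Ls ((i - k) div k) ((i - k) mod k) b, c))"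

lemma bottom_row_less:
  assumes "i < n * k"
  shows "(i - k) div k < k" "(i - k) mod k < k"
proof -
  have "n * k = k + k * k"
    using n by simp
  then have "i - k < k * k"
    \<comment> \<open>For \<open>i < k\<close> the truncated difference is 0, which is below
      \<open>k * k\<close> because \<open>k\<close> is positive.\<close>
    using assms k by (cases "k \<le> i") auto
  then show "(i - k) div k < k"
    by (rule less_mult_imp_div_less)
  show "(i - k) mod k < k"
    using k by simp
qed

text \<open>This passes from the stacked block layout to the closed form on which the root and
  orthogonality arguments work.\<close>

lemma scarpis_index:
  assumes "i < n * k" "l < n * k"
  shows "scarpis (map latin_tensor Ls) H $$ (i, l) = scarpis_entry i (l div k) (l mod k)"
proof -
  let ?Xs = "map latin_tensor Ls"
  let ?b = "l div k" and ?c = "l mod k"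
  have dims: "n * k = k + k * k"
    using n by simp
  have b: "?b < n"
    using assms(2) by (rule less_mult_imp_div_less)
  have c: "?c < k"
    using k by simp
  note top = scarpis_top_carrier and bottom = scarpis_bottom_carrier[of ?Xs]
  show ?thesis
  proof (cases "i < k")
    case True
    then have "scarpis ?Xs H $$ (i, l) = scarpis_top H $$ (i, l)"
      using top bottom assms by (simp add: scarpis_def append_rows_def)
    also have "\<dots> = H $$ (Suc i, ?b)"
      using True assms b c
      by (simp add: scarpis_top_def kronecker_def block_matrix_def delete_first_row_def ones_row_def)
    finally show ?thesis
      using True by (simp add: scarpis_entry_def)
  next
    case False
    define a r where "a = (i - k) div k" and "r = (i - k) mod k"
    have ar: "a < k" "r < k"
      using bottom_row_less[OF assms(1)] by (simp_all add: a_def r_def)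
    have i: "i - k < k * k"
      using False assms(1) dims by linarith
    have "scarpis ?Xs H $$ (i, l) = scarpis_bottom ?Xs H $$ (i - k, l)"
      using top bottom assms False i dims by (simp add: scarpis_def append_rows_def)
    also have "\<dots> = (if ?b = 0
          then kronecker (transpose_mat (ones_row k)) (mat_of_row (row (core H) a))
        else if a = 0 then core H
        else frontal_slice (?Xs ! (a - 1)) (?b - 1) * core H) $$ (r, ?c)"
      using i assms(2) by (simp add: scarpis_bottom_def Let_def block_matrix_def a_def r_def)
    also have "\<dots> = core H $$ (scarpis_symbol Ls a r ?b, ?c)"
    proof -
      consider "?b = 0" | "?b \<noteq> 0" "a = 0" | "?b \<noteq> 0" "a \<noteq> 0"
        by blast
      then show ?thesis
      proof cases
        case 1
        have "kronecker (transpose_mat (ones_row k)) (mat_of_row (row (core H) a)) $$ (r, ?c) =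
            core H $$ (a, ?c)"
          using ar c by (simp add: kronecker_def block_matrix_def ones_row_def)
        with 1 show ?thesis
          by (simp only: scarpis_symbol_def simp_thms if_True)
      next
        case 2
        then show ?thesis
          by (simp only: scarpis_symbol_def simp_thms if_True if_False)
      next
        case 3
        have "?Xs ! (a - 1) = latin_tensor (Ls ! (a - 1))"
          using 3 ar length_Ls by simp
        moreover have "(frontal_slice (latin_tensor (Ls ! (a - 1))) (?b - 1) * core H) $$ (r, ?c) =
            core H $$ ((Ls ! (a - 1)) $$ (r, ?b - 1) - 1, ?c)"
          using 3 ar b c n by (intro slice_times_core_index) linarith+
        ultimately show ?thesis
          using 3 by (simp only: scarpis_symbol_def if_False)
      qed
    qed
    finally show ?thesis
      using False by (simp add: scarpis_entry_def a_def r_def)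
  qed
qed

section \<open>Roots of unity and orthogonality of the rows\<close>

lemma scarpis_entry_root:
  assumes "i < n * k" "b < n" "c < k"
  shows "scarpis_entry i b c ^ m = 1"
proof (cases "i < k")
  case True
  then show ?thesis
    using assms by (simp add: scarpis_entry_def H_root)
next
  case False
  have "core H $$ (x, c) ^ m = 1" if "x < k" for x
    using that assms(3) by (simp add: core_index H_root)
  then show ?thesis
    using False scarpis_symbol_less[OF bottom_row_less[OF assms(1)] assms(2)]
    by (simp add: scarpis_entry_def)
qed

text \<open>Within a block the top row is constant and factors out, while the bottom row sums to -1.
  What remains is minus a row sum of \<open>H\<close>.\<close>

lemma top_bottom_inner:
  assumes "i < k" "k \<le> j" "j < n * k"
  shows "(\<Sum>b<n. \<Sum>c<k. scarpis_entry i b c * cnj (scarpis_entry j b c)) = 0"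
proof -
  have "(\<Sum>c<k. scarpis_entry i b c * cnj (scarpis_entry j b c)) = - H $$ (Suc i, b)"
    if "b < n" for b
  proof -
    have "(\<Sum>c<k. scarpis_entry i b c * cnj (scarpis_entry j b c)) =
        H $$ (Suc i, b) * cnj (\<Sum>c<k. scarpis_entry j b c)"
      using assms(1) by (simp add: scarpis_entry_def sum_distrib_left)
    also have "(\<Sum>c<k. scarpis_entry j b c) = -1"
      using assms(2) core_row_sum[OF scarpis_symbol_less[OF bottom_row_less[OF assms(3)] that]]
      by (simp add: scarpis_entry_def)
    finally show ?thesis
      by simp
  qed
  then have "(\<Sum>b<n. \<Sum>c<k. scarpis_entry i b c * cnj (scarpis_entry j b c)) =
      - (\<Sum>b<n. H $$ (Suc i, b))"
    by (simp add: sum_negf)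
  then show ?thesis
    using sum_H_row[of "Suc i"] assms(1) by simp
qed

text \<open>A block contributes \<open>n - 1\<close> where the words agree and -1 elsewhere, so
  \<open>e\<close> agreements give \<open>n * e - n\<close>. Equal rows have \<open>e = n\<close>,
  hence \<open>n * k\<close>; different rows have \<open>e = 1\<close>, hence 0.\<close>

lemma bottom_bottom_inner:
  assumes "k \<le> i" "i < n * k" "k \<le> j" "j < n * k"
  shows "(\<Sum>b<n. \<Sum>c<k. scarpis_entry i b c * cnj (scarpis_entry j b c)) =
      (if i = j then of_nat (n * k) else 0)"
proof -
  define a r a' r' where "a = (i - k) div k" and "r = (i - k) mod k"
    and "a' = (j - k) div k" and "r' = (j - k) mod k"
  note defs = a_def r_def a'_def r'_def
  have less: "a < k" "r < k" "a' < k" "r' < k"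
    unfolding defs by (intro bottom_row_less assms)+
  let ?A = "{b. b < n \<and> scarpis_symbol Ls a r b = scarpis_symbol Ls a' r' b}"
  have "(\<Sum>b<n. \<Sum>c<k. scarpis_entry i b c * cnj (scarpis_entry j b c)) =
      (\<Sum>b<n. (if scarpis_symbol Ls a r b = scarpis_symbol Ls a' r' b then of_nat n else 0) - 1)"
  proof (rule sum.cong[OF refl])
    fix b assume "b \<in> {..<n}"
    then have b: "b < n"
      by simp
    show "(\<Sum>c<k. scarpis_entry i b c * cnj (scarpis_entry j b c)) =
      (if scarpis_symbol Ls a r b = scarpis_symbol Ls a' r' b then of_nat n else 0) - 1"
      using core_inner[OF scarpis_symbol_less[OF less(1,2) b] scarpis_symbol_less[OF less(3,4) b]]
        assms(1,3) by (simp add: scarpis_entry_def defs)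
  qed
  also have "\<dots> = (\<Sum>b<n. if scarpis_symbol Ls a r b = scarpis_symbol Ls a' r' b
      then of_nat n else 0) - of_nat n"
    by (simp add: sum_subtractf)
  also have "(\<Sum>b<n. if scarpis_symbol Ls a r b = scarpis_symbol Ls a' r' b
      then of_nat n else 0) = of_nat (card ?A) * (of_nat n :: complex)"
    by (subst sum.inter_filter[symmetric]) auto
  also have "of_nat (card ?A) * of_nat n - of_nat n =
      (if i = j then of_nat (n * k) else 0 :: complex)"
  proof (cases "i = j")
    case True
    then have "?A = {..<n}"
      by (auto simp: defs)
    then have "card ?A = n"
      by simp
    then show ?thesis
      using True n by (simp add: of_nat_diff algebra_simps)
  next
    case False
    have "(a, r) \<noteq> (a', r')"
    proof
      assume "(a, r) = (a', r')"
      \<comment> \<open>Quotient and remainder by \<open>k\<close> determine the index of a bottom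
        row.\<close>
      then have "i - k = j - k"
        unfolding defs by (metis Pair_inject div_mult_mod_eq)
      then show False
        using False assms by simp
    qed
    then have "card ?A = 1"
      using less by (intro card_agreements)
    then show ?thesis
      using False by simp
  qed
  finally show ?thesis .
qed

lemma scarpis_entry_orthogonal:
  assumes "i < n * k" "j < n * k"
  shows "(\<Sum>b<n. \<Sum>c<k. scarpis_entry i b c * cnj (scarpis_entry j b c)) =
      (if i = j then of_nat (n * k) else 0)"
proof -
  consider "i < k" "j < k" | "i < k" "k \<le> j" | "k \<le> i" "j < k"
    | "k \<le> i" "k \<le> j"
    by linarith
  then show ?thesis
  proof cases
    case 1
    \<comment> \<open>Both top rows are constant on each block, so every product of entries of
      \<open>H\<close> is counted \<open>k\<close> times.\<close>
    then have "(\<Sum>b<n. \<Sum>c<k. scarpis_entry i b c * cnj (scarpis_entry j b c)) =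
        of_nat k * (\<Sum>b<n. H $$ (Suc i, b) * cnj (H $$ (Suc j, b)))"
      by (simp add: scarpis_entry_def sum_distrib_left)
    also have "\<dots> = of_nat k * (if i = j then of_nat n else 0)"
      using 1 by (subst H_orthogonal) auto
    finally show ?thesis
      by (simp add: mult.commute)
  next
    case 2
    then show ?thesis
      using top_bottom_inner assms by auto
  next
    case 3
    \<comment> \<open>Exchanging the two rows conjugates the inner product, which reduces this case
      to the previous one.\<close>
    have "(\<Sum>b<n. \<Sum>c<k. scarpis_entry i b c * cnj (scarpis_entry j b c)) =
        cnj (\<Sum>b<n. \<Sum>c<k. scarpis_entry j b c * cnj (scarpis_entry i b c))"
      by (simp add: mult.commute)
    also have "\<dots> = 0"
      using top_bottom_inner[of j i] 3 assms by (simp only: complex_cnj_zero)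
    finally show ?thesis
      using 3 by auto
  next
    case 4
    then show ?thesis
      using bottom_bottom_inner assms by blast
  qed
qed

lemma butson_scarpis: "butson m (n * k) (scarpis (map latin_tensor Ls) H)"
  unfolding butson_iff
proof (intro conjI allI impI)
  let ?M = "scarpis (map latin_tensor Ls) H"
  show "?M \<in> carrier_mat (n * k) (n * k)"
    by (rule scarpis_carrier)
  fix i j
  assume ij: "i < n * k" "j < n * k"
  have "j div k < n" "j mod k < k"
    using less_mult_imp_div_less[OF ij(2)] k by auto
  then show "?M $$ (i, j) ^ m = 1"
    using ij by (simp add: scarpis_index scarpis_entry_root)
  have "(\<Sum>l<n * k. ?M $$ (i, l) * cnj (?M $$ (j, l))) =
      (\<Sum>l<n * k. scarpis_entry i (l div k) (l mod k) *
        cnj (scarpis_entry j (l div k) (l mod k)))"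
    using ij by (intro sum.cong) (auto simp: scarpis_index)
  also have "\<dots> = (\<Sum>b<n. \<Sum>c<k. scarpis_entry i b c * cnj (scarpis_entry j b c))"
    by (rule sum_div_mod)
  also have "\<dots> = (if i = j then of_nat (n * k) else 0)"
    using ij by (rule scarpis_entry_orthogonal)
  finally show "(\<Sum>l<n * k. ?M $$ (i, l) * cnj (?M $$ (j, l))) =
      (if i = j then of_nat (n * k) else 0)" .
qed

end

theorem theorem1:
  fixes m n :: nat
    and H :: "complex mat"
    and Xs :: "complex tensor3 list"
  assumes "m \<ge> 1" and "n \<ge> 2"
    and "H \<in> normalized_butson m n"
    and "length Xs = n - 2"
    and "complete_lsesc_tensors (n - 1) (set Xs)"
  shows "butson m (n * (n - 1)) (scarpis Xs H)"
proof -
  have "length Xs = n - 1 - 1"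
    using assms(4) by simp
  then obtain Ls where Ls: "Xs = map latin_tensor Ls" "distinct Ls"
    "\<forall>L\<in>set Ls. latin_square (n - 1) L" "pairwise (lsesc (n - 1)) (set Ls)"
    using complete_lsesc_tensors_listE[OF assms(5)] by blast
  \<comment> \<open>With \<open>k = n - 1\<close>, the bound \<open>n \<ge> 2\<close> yields both
    \<open>n = Suc k\<close> and \<open>0 < k\<close>.\<close>
  have "scarpis_construction m n (n - 1) H Ls"
    using assms Ls by unfold_locales auto
  then show ?thesis
    unfolding Ls(1) by (rule scarpis_construction.butson_scarpis)
qed

end
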